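(* Fix a time domain $\mathbb{T}$ and a semantics $\psi$ (used to define the flow generator $\Delta_\psi$). Let $A=\langle \mathcal{S},\mathcal{S}_0,\iota,\varphi\rangle$ be an algorithm (relative to $\psi$) over a finite vocabulary $\mathcal{V}$. Then there is an ASM program $\Pi$ over $\mathcal{V}$ such that $\mathrm{gen}(\Pi,X)=\mathrm{gen}(X)$ for every state $X\in\mathcal{S}$.
   Context: Time: a set $\mathbb{T}$ with an associative binary operation $+$ having a neutral element $0$, and a total order $\le$ preserved by $+$ ($t\le t'$ implies $t+t''\le t'+t''$). A timeline is a subset of $\mathbb{T}$ containing $0$; $\mathbb{I}$ is the set of timelines. For a moment $i$ of a timeline $I$, $i$ is called discrete if there is $t\in I$ with $i<t$ and no $t'\in I$ with $i<t'<t$; then $i^+$ denotes the smallest element of $I$ greater than $i$. Otherwise $i$ is called continuous. $I$ is non-Zeno if for each $i\in I$ there are only finitely many discrete $j\in I$ with $j\le i$. The truncation is $I[i]=\{t\mid i+t\in I\}$. A dynamical system $\langle\mathcal{S},\mathcal{S}_0,\iota,\varphi\rangle$ consists of a nonempty class $\mathcal{S}$ of states, a nonempty subclass $\mathcal{S}_0$ of initial states, a map $\iota:\mathcal{S}\to\mathbb{I}$ whose values are all non-Zeno, and a map $\varphi$ assigning to each $X\in\mathcal{S}$ and $i\in\iota(X)$ a state $\varphi(X,i)$, such that for all $X$ and $i,i+i'\in\iota(X)$: $\varphi(X,0)=X$, $\iota(\varphi(X,i))=\iota(X)[i]$, $\varphi(X,i+i')=\varphi(\varphi(X,i),i')$.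 A vocabulary is a finite set of function symbols with arities (some tagged relational; it contains the nullary symbol $\mathit{true}$); structures over it and isomorphisms of structures are the usual first-order notions. An abstract transition system is a dynamical system whose states are structures over a finite vocabulary $\mathcal{V}$ such that: (1) any structure isomorphic to a state is a state, and is initial if the original is; (2) $\varphi(X,i)$ has the same base set as $X$; (3) if $\zeta$ is an isomorphism $X\cong Y$ of states then $\iota(X)=\iota(Y)$ and $\zeta$ is an isomorphism $\varphi(X,i)\cong\varphi(Y,i)$ for every $i\in\iota(X)$. A location of $X$ is a pair $(f,\bar a)$ with $f$ a $j$-ary symbol and $\bar a$ a $j$-tuple of elements of $X$; its value is $f^X(\bar a)$. An update is a triple $(f,\bar a,b)$ with $b$ an element. For structures $X,Y$ with the same base set and vocabulary, $Y\setminus X$ is the set of updates $(f,\bar a,f^Y(\bar a))$ with $f^Y(\bar a)\neq f^X(\bar a)$. A state $X$ is a jump if $0$ is discrete in $\iota(X)$, and a flow otherwise. For a jump, $\Delta^+(X)=\varphi(X,0^+)\setminus X$. A semantics $\psi$ over a class $\mathcal{C}$ of sets is a partial function mapping each function from a timeline into some $S\in\mathcal{C}$ (an initial evolution) to an element of $S$. An initial evolution is initially constant if it is constant on $[0,t]$ for some $t>0$. For a state $X$ and location $(f,\bar a)$, the evolution $\mathrm{Evolution}(X,(f,\bar a))$ is $t\mapsto f^{\varphi(X,t)}(\bar a)$ for $t\in\iota(X)$, $0\le t\le I_1$, for some $I_1\in\iota(X)$ ($I_1=0^+$ for a jump); $\psi[X,f,\bar a]$ is its image under $\psi$. When $\psi[X,f,\bar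 a]$ is defined for all locations, $\Delta_\psi(X)$ is the set of updates $(f,\bar a,\psi[X,f,\bar a])$ over all locations $(f,\bar a)$ whose evolution is not initially constant. The tagged generator of a state $X$ is $\mathrm{gen}(X)=(\mathcal{F},\Delta_\psi(X))$ if $X$ is a flow and $\Delta_\psi(X)$ is defined, and $\mathrm{gen}(X)=(\mathcal{J},\Delta^+(X))$ if $X$ is a jump. An algorithm (relative to $\psi$) is an abstract transition system for which there is a finite set $T$ of ground terms over $\mathcal{V}$ (critical terms) such that whenever states $X,Y$ satisfy $t^X=t^Y$ for all $t\in T$, both $\mathrm{gen}(X)$ and $\mathrm{gen}(Y)$ exist and are equal. ASM programs (rules) over $\mathcal{V}$ and their interpretation $\mathrm{gen}(R,X)$: an update rule $f(t_1,\dots,t_j):=t_0$ ($t_i$ ground terms) gives $(\mathcal{J},\{(f,(t_1^X,\dots,t_j^X),t_0^X)\})$; a parallel rule $\texttt{par } R_1\dots R_k \texttt{ endpar}$ of update rules gives $(\mathcal{J},d_1\cup\dots\cup d_k)$ where $\mathrm{gen}(R_i,X)=(\mathcal{J},d_i)$; a basic continuous rule $\textsc{Dynamic}(f(t_1,\dots,t_j),t_0)$ gives $(\mathcal{F},\{(f,(t_1^X,\dots,t_j^X),t_0^X)\})$; a flow rule $\texttt{flow } R_1\dots R_k\texttt{ endflow}$ of basic continuous rules gives $(\mathcal{F},d_1\cup\dots\cup d_k)$ where $\mathrm{gen}(R_i,X)=(\mathcal{F},d_i)$; a selection rule $\texttt{if } \varphi \texttt{ then } R_1 \texttt{ else } R_2\texttt{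 endif}$ ($\varphi$ a ground Boolean term) gives $\mathrm{gen}(R_1,X)$ if $\varphi^X=\mathit{true}^X$ and $\mathrm{gen}(R_2,X)$ otherwise. An ASM program is a rule.
   Formalization: Added (the claim fails otherwise): on flow states of A, isomorphisms of states carry the ψ-values of locations that are not initially constant to each other. Guards may use equality and connectives as logical symbols, blocks may be empty, and I_1>0 whenever the timeline has positive moments. *)

theory Defs
  imports Main
begin

section \<open>Time and timelines\<close>

text \<open>The operation need not be commutative, and the order is only required to be preserved by
  adding a common right summand.\<close>

class time_domain = monoid_add + linorder +
  assumes time_add_right_mono: "t \<le> t' \<Longrightarrow> t + t'' \<le> t' + t''"

definition timeline :: "'tm::time_domain set \<Rightarrow> bool" where
  "timeline I \<longleftrightarrow> 0 \<in> I"

definition discrete :: "'tm::time_domain set \<Rightarrow> 'tm \<Rightarrow> bool" where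
  "discrete I i \<longleftrightarrow> i \<in> I \<and> (\<exists>t\<in>I. i < t \<and> \<not> (\<exists>t'\<in>I. i < t' \<and> t' < t))"

text \<open>The moment \<open>i\<^sup>+\<close>; meaningful only if \<open>i\<close> is discrete in \<open>I\<close>.\<close>

definition succ_moment :: "'tm::time_domain set \<Rightarrow> 'tm \<Rightarrow> 'tm" where
  "succ_moment I i = (LEAST t. t \<in> I \<and> i < t)"

definition non_Zeno :: "'tm::time_domain set \<Rightarrow> bool" where
  "non_Zeno I \<longleftrightarrow> (\<forall>i\<in>I. finite {j. discrete I j \<and> j \<le> i})"

definition truncation :: "'tm::time_domain set \<Rightarrow> 'tm \<Rightarrow> 'tm set" where
  "truncation I i = {t. i + t \<in> I}"


section \<open>Dynamical systems\<close>

record ('s, 'tm) system =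
  states :: "'s set"
  initial :: "'s set"
  tline :: "'s \<Rightarrow> 'tm set"
  traj :: "'s \<Rightarrow> 'tm \<Rightarrow> 's"

definition dynamical_system :: "('s, 'tm::time_domain) system \<Rightarrow> bool" where
  "dynamical_system A \<longleftrightarrow>
     states A \<noteq> {} \<and> initial A \<noteq> {} \<and> initial A \<subseteq> states A \<and>
     (\<forall>X\<in>states A. timeline (tline A X) \<and> non_Zeno (tline A X)) \<and>
     (\<forall>X\<in>states A. \<forall>i\<in>tline A X. traj A X i \<in> states A) \<and>
     (\<forall>X\<in>states A. traj A X 0 = X) \<and>
     (\<forall>X\<in>states A. \<forall>i\<in>tline A X. tline A (traj A X i) = truncation (tline A X) i) \<and>
     (\<forall>X\<in>states A. \<forall>i i'. i \<in> tline A X \<and> i + i' \<in> tline A X \<longrightarrow>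
        traj A X (i + i') = traj A (traj A X i) i')"

definition jump :: "('s, 'tm::time_domain) system \<Rightarrow> 's \<Rightarrow> bool" where
  "jump A X \<longleftrightarrow> discrete (tline A X) 0"


section \<open>Vocabularies, structures, terms\<close>

record 'f vocab =
  syms :: "'f set"
  arity :: "'f \<Rightarrow> nat"
  rels :: "'f set"
  true_sym :: 'f

definition vocabulary :: "'f vocab \<Rightarrow> bool" where
  "vocabulary V \<longleftrightarrow> finite (syms V) \<and> rels V \<subseteq> syms V \<and>
     true_sym V \<in> syms V \<and> arity V (true_sym V) = 0"

record ('f, 'a) struct =
  base :: "'a set"
  interp :: "'f \<Rightarrow> 'a list \<Rightarrow> 'a"

definition location :: "'f vocab \<Rightarrow> ('f, 'a) struct \<Rightarrow> 'f \<Rightarrow> 'a list \<Rightarrow> bool" where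
  "location V X f as \<longleftrightarrow> f \<in> syms V \<and> length as = arity V f \<and> set as \<subseteq> base X"

text \<open>Interpretations are normalised to \<^const>\<open>undefined\<close> away from the locations, so that HOL
  equality of structures over \<open>V\<close> is equality of structures in the usual sense.\<close>

definition struct_over :: "'f vocab \<Rightarrow> ('f, 'a) struct \<Rightarrow> bool" where
  "struct_over V X \<longleftrightarrow> base X \<noteq> {} \<and>
     (\<forall>f as. location V X f as \<longrightarrow> interp X f as \<in> base X) \<and>
     (\<forall>f as. \<not> location V X f as \<longrightarrow> interp X f as = undefined)"

definition isomorphism ::
    "'f vocab \<Rightarrow> ('a \<Rightarrow> 'a) \<Rightarrow> ('f, 'a) struct \<Rightarrow> ('f, 'a) struct \<Rightarrow> bool" where
  "isomorphism V \<zeta> X Y \<longleftrightarrow> bij_betw \<zeta> (base X) (base Y) \<and>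
     (\<forall>f as. location V X f as \<longrightarrow> interp Y f (map \<zeta> as) = \<zeta> (interp X f as))"

datatype 'f gterm = App 'f "'f gterm list"

fun term_over :: "'f vocab \<Rightarrow> 'f gterm \<Rightarrow> bool" where
  "term_over V (App f ts) \<longleftrightarrow> f \<in> syms V \<and> length ts = arity V f \<and> (\<forall>t\<in>set ts. term_over V t)"

fun val :: "('f, 'a) struct \<Rightarrow> 'f gterm \<Rightarrow> 'a" where
  "val X (App f ts) = interp X f (map (val X) ts)"


section \<open>Abstract transition systems\<close>

text \<open>The elements of all base sets are drawn from one ambient type \<open>'a\<close>, which plays the role of
  the set-theoretic universe; closure under isomorphism is closure within that universe.  Like the
  universe, \<open>'a\<close> should be infinite, so that isomorphic copies can avoid any given element.\<close>

definition abstract_transition_system ::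
    "'f vocab \<Rightarrow> (('f, 'a) struct, 'tm::time_domain) system \<Rightarrow> bool" where
  "abstract_transition_system V A \<longleftrightarrow>
     dynamical_system A \<and>
     (\<forall>X\<in>states A. struct_over V X) \<and>
     (\<forall>X\<in>states A. \<forall>Y \<zeta>. struct_over V Y \<and> isomorphism V \<zeta> X Y \<longrightarrow>
        Y \<in> states A \<and> (X \<in> initial A \<longrightarrow> Y \<in> initial A)) \<and>
     (\<forall>X\<in>states A. \<forall>i\<in>tline A X. base (traj A X i) = base X) \<and>
     (\<forall>X\<in>states A. \<forall>Y\<in>states A. \<forall>\<zeta>. isomorphism V \<zeta> X Y \<longrightarrow>
        tline A X = tline A Y \<and>
        (\<forall>i\<in>tline A X. isomorphism V \<zeta> (traj A X i) (traj A Y i)))"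


section \<open>Semantics and generators\<close>

type_synonym ('f, 'a) update = "'f \<times> 'a list \<times> 'a"

text \<open>The set \<open>Y \ X\<close>.\<close>

definition struct_diff ::
    "'f vocab \<Rightarrow> ('f, 'a) struct \<Rightarrow> ('f, 'a) struct \<Rightarrow> ('f, 'a) update set" where
  "struct_diff V Y X =
     {(f, as, interp Y f as) | f as. location V X f as \<and> interp Y f as \<noteq> interp X f as}"

definition jump_updates ::
    "'f vocab \<Rightarrow> (('f, 'a) struct, 'tm::time_domain) system \<Rightarrow> ('f, 'a) struct
     \<Rightarrow> ('f, 'a) update set" where
  "jump_updates V A X = struct_diff V (traj A X (succ_moment (tline A X) 0)) X"

text \<open>Functions from a timeline are partial functions on times.  A semantics receives an initial
  evolution together with the set it is regarded as a function into.\<close>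

type_synonym ('tm, 'a) semantics = "'a set \<Rightarrow> ('tm \<rightharpoonup> 'a) \<rightharpoonup> 'a"

definition initial_evolution :: "'a set \<Rightarrow> ('tm::time_domain \<rightharpoonup> 'a) \<Rightarrow> bool" where
  "initial_evolution S e \<longleftrightarrow> timeline (dom e) \<and> ran e \<subseteq> S"

definition semantics_over :: "'a set set \<Rightarrow> ('tm::time_domain, 'a) semantics \<Rightarrow> bool" where
  "semantics_over \<C> \<psi> \<longleftrightarrow>
     (\<forall>S e b. \<psi> S e = Some b \<longrightarrow> S \<in> \<C> \<and> initial_evolution S e \<and> b \<in> S)"

text \<open>Intervals are intervals of the timeline on which the evolution is defined.\<close>

definition initially_constant :: "('tm::time_domain \<rightharpoonup> 'a) \<Rightarrow> bool" where
  "initially_constant e \<longleftrightarrow> (\<exists>t\<in>dom e. 0 < t \<and> (\<forall>s\<in>dom e. 0 \<le> s \<and> s \<le> t \<longrightarrow> e s = e 0))"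

text \<open>A horizon selects, for each state and location, the final moment \<open>I\<^sub>1\<close> of the initial segment
  on which the evolution is considered.  The segment reaches beyond \<open>0\<close> whenever the timeline does.\<close>

type_synonym ('f, 'a, 'tm) horizon = "('f, 'a) struct \<Rightarrow> 'f \<Rightarrow> 'a list \<Rightarrow> 'tm"

definition horizon_for ::
    "'f vocab \<Rightarrow> (('f, 'a) struct, 'tm::time_domain) system \<Rightarrow> ('f, 'a, 'tm) horizon \<Rightarrow> bool" where
  "horizon_for V A h \<longleftrightarrow>
     (\<forall>X\<in>states A. \<forall>f as. location V X f as \<longrightarrow>
        h X f as \<in> tline A X \<and> 0 \<le> h X f as \<and>
        ((\<exists>t\<in>tline A X. 0 < t) \<longrightarrow> 0 < h X f as) \<and>
        (jump A X \<longrightarrow> h X f as = succ_moment (tline A X) 0))"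

definition evolution ::
    "(('f, 'a) struct, 'tm::time_domain) system \<Rightarrow> ('f, 'a, 'tm) horizon
     \<Rightarrow> ('f, 'a) struct \<Rightarrow> 'f \<Rightarrow> 'a list \<Rightarrow> ('tm \<rightharpoonup> 'a)" where
  "evolution A h X f as =
     (\<lambda>t. if t \<in> tline A X \<and> 0 \<le> t \<and> t \<le> h X f as then Some (interp (traj A X t) f as) else None)"

text \<open>The partial value \<open>\<psi>[X, f, as]\<close>.\<close>

definition psi_value ::
    "('tm, 'a) semantics \<Rightarrow> ('f, 'a, 'tm) horizon
     \<Rightarrow> (('f, 'a) struct, 'tm::time_domain) system \<Rightarrow> ('f, 'a) struct \<Rightarrow> 'f \<Rightarrow> 'a list \<Rightarrow> 'a option" where
  "psi_value \<psi> h A X f as = \<psi> (base X) (evolution A h X f as)"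

definition flow_updates ::
    "'f vocab \<Rightarrow> ('tm, 'a) semantics \<Rightarrow> ('f, 'a, 'tm) horizon
     \<Rightarrow> (('f, 'a) struct, 'tm::time_domain) system \<Rightarrow> ('f, 'a) struct
     \<Rightarrow> ('f, 'a) update set option" where
  "flow_updates V \<psi> h A X =
     (if \<forall>f as. location V X f as \<longrightarrow> psi_value \<psi> h A X f as \<noteq> None
      then Some {(f, as, the (psi_value \<psi> h A X f as)) | f as.
                   location V X f as \<and> \<not> initially_constant (evolution A h X f as)}
      else None)"

datatype tag = FlowTag | JumpTag

definition gen ::
    "'f vocab \<Rightarrow> ('tm, 'a) semantics \<Rightarrow> ('f, 'a, 'tm) horizon
     \<Rightarrow> (('f, 'a) struct, 'tm::time_domain) system \<Rightarrow> ('f, 'a) struct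
     \<Rightarrow> (tag \<times> ('f, 'a) update set) option" where
  "gen V \<psi> h A X =
     (if jump A X then Some (JumpTag, jump_updates V A X)
      else map_option (Pair FlowTag) (flow_updates V \<psi> h A X))"

definition algorithm ::
    "'f vocab \<Rightarrow> ('tm, 'a) semantics \<Rightarrow> ('f, 'a, 'tm) horizon
     \<Rightarrow> (('f, 'a) struct, 'tm::time_domain) system \<Rightarrow> bool" where
  "algorithm V \<psi> h A \<longleftrightarrow>
     abstract_transition_system V A \<and>
     (\<exists>T. finite T \<and> (\<forall>t\<in>T. term_over V t) \<and>
        (\<forall>X\<in>states A. \<forall>Y\<in>states A. (\<forall>t\<in>T. val X t = val Y t) \<longrightarrow>
           gen V \<psi> h A X \<noteq> None \<and> gen V \<psi> h A Y \<noteq> None \<and> gen V \<psi> h A X = gen V \<psi> h A Y))"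

text \<open>The values of \<open>\<psi>\<close> that enter flow generators are transported by isomorphisms of states.
  This does not follow from \<^const>\<open>algorithm\<close>.  Take \<open>\<psi> S e\<close> to be the least value of \<open>e\<close> for some
  fixed linear order on \<open>'a\<close>, nullary symbols \<open>c\<close>, \<open>d\<close>, \<open>f\<close>, and nonnegative real time, with \<open>f\<close>
  passing from \<open>c\<close> at time \<open>0\<close> to \<open>d\<close> at all positive times, and constant if \<open>f\<close> differs from \<open>c\<close>
  initially: the generators are determined by the values of \<open>c\<close>, \<open>d\<close>, \<open>f\<close>, yet isomorphic states
  have generators that do not correspond, whereas the interpretation of every program commutes
  with isomorphisms.\<close>

definition psi_iso_invariant ::
    "'f vocab \<Rightarrow> ('tm, 'a) semantics \<Rightarrow> ('f, 'a, 'tm) horizon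
     \<Rightarrow> (('f, 'a) struct, 'tm::time_domain) system \<Rightarrow> bool" where
  "psi_iso_invariant V \<psi> h A \<longleftrightarrow>
     (\<forall>X\<in>states A. \<forall>Y\<in>states A. \<forall>\<zeta>. isomorphism V \<zeta> X Y \<and> \<not> jump A X \<longrightarrow>
        (\<forall>f as. location V X f as \<and> \<not> initially_constant (evolution A h X f as) \<longrightarrow>
           psi_value \<psi> h A Y f (map \<zeta> as) = map_option \<zeta> (psi_value \<psi> h A X f as)))"


section \<open>Programs\<close>

text \<open>Ground Boolean terms of first-order logic with equality: equality and the connectives are
  logical symbols, available over every vocabulary, and a relational term is true when its value
  is that of the symbol \<open>true\<close>.\<close>

datatype 'f bterm =
    Rel "'f gterm"
  | Eq "'f gterm" "'f gterm"
  | Neg "'f bterm"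
  | Conj "'f bterm" "'f bterm"

fun head :: "'f gterm \<Rightarrow> 'f" where
  "head (App f ts) = f"

fun bterm_over :: "'f vocab \<Rightarrow> 'f bterm \<Rightarrow> bool" where
  "bterm_over V (Rel t) \<longleftrightarrow> term_over V t \<and> head t \<in> rels V"
| "bterm_over V (Eq s t) \<longleftrightarrow> term_over V s \<and> term_over V t"
| "bterm_over V (Neg b) \<longleftrightarrow> bterm_over V b"
| "bterm_over V (Conj b c) \<longleftrightarrow> bterm_over V b \<and> bterm_over V c"

fun holds :: "'f vocab \<Rightarrow> ('f, 'a) struct \<Rightarrow> 'f bterm \<Rightarrow> bool" where
  "holds V X (Rel t) \<longleftrightarrow> val X t = val X (App (true_sym V) [])"
| "holds V X (Eq s t) \<longleftrightarrow> val X s = val X t"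
| "holds V X (Neg b) \<longleftrightarrow> \<not> holds V X b"
| "holds V X (Conj b c) \<longleftrightarrow> holds V X b \<and> holds V X c"

text \<open>\<open>Update f ts t\<close> is the rule \<open>f(ts) := t\<close>, and \<open>Dynamic f ts t\<close> the rule \<open>Dynamic(f(ts), t)\<close>.\<close>

datatype 'f update_rule = Update 'f "'f gterm list" "'f gterm"

datatype 'f dynamic_rule = Dynamic 'f "'f gterm list" "'f gterm"

text \<open>Parallel and flow rules may have no components.  Without that, a generator with the empty
  set of updates would not be the interpretation of any rule.\<close>

datatype 'f asm_rule =
    Assign "'f update_rule"
  | Par "'f update_rule list"
  | Continuous "'f dynamic_rule"
  | Flow "'f dynamic_rule list"
  | Select "'f bterm" "'f asm_rule" "'f asm_rule"

fun update_rule_over :: "'f vocab \<Rightarrow> 'f update_rule \<Rightarrow> bool" where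
  "update_rule_over V (Update f ts t) \<longleftrightarrow> term_over V (App f ts) \<and> term_over V t"

fun dynamic_rule_over :: "'f vocab \<Rightarrow> 'f dynamic_rule \<Rightarrow> bool" where
  "dynamic_rule_over V (Dynamic f ts t) \<longleftrightarrow> term_over V (App f ts) \<and> term_over V t"

fun asm_program :: "'f vocab \<Rightarrow> 'f asm_rule \<Rightarrow> bool" where
  "asm_program V (Assign R) \<longleftrightarrow> update_rule_over V R"
| "asm_program V (Par Rs) \<longleftrightarrow> (\<forall>R\<in>set Rs. update_rule_over V R)"
| "asm_program V (Continuous R) \<longleftrightarrow> dynamic_rule_over V R"
| "asm_program V (Flow Rs) \<longleftrightarrow> (\<forall>R\<in>set Rs. dynamic_rule_over V R)"
| "asm_program V (Select b R1 R2) \<longleftrightarrow> bterm_over V b \<and> asm_program V R1 \<and> asm_program V R2"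

fun update_set :: "('f, 'a) struct \<Rightarrow> 'f update_rule \<Rightarrow> ('f, 'a) update set" where
  "update_set X (Update f ts t) = {(f, map (val X) ts, val X t)}"

fun dynamic_set :: "('f, 'a) struct \<Rightarrow> 'f dynamic_rule \<Rightarrow> ('f, 'a) update set" where
  "dynamic_set X (Dynamic f ts t) = {(f, map (val X) ts, val X t)}"

fun gen_rule ::
    "'f vocab \<Rightarrow> 'f asm_rule \<Rightarrow> ('f, 'a) struct \<Rightarrow> tag \<times> ('f, 'a) update set" where
  "gen_rule V (Assign R) X = (JumpTag, update_set X R)"
| "gen_rule V (Par Rs) X = (JumpTag, \<Union>R\<in>set Rs. update_set X R)"
| "gen_rule V (Continuous R) X = (FlowTag, dynamic_set X R)"
| "gen_rule V (Flow Rs) X = (FlowTag, \<Union>R\<in>set Rs. dynamic_set X R)"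
| "gen_rule V (Select b R1 R2) X = (if holds V X b then gen_rule V R1 X else gen_rule V R2 X)"

end

theory Submission
  imports Defs
begin

text \<open>
  Isomorphic copies do all the work.  If an update of a state \<open>X\<close> mentioned an element \<open>a\<close> that is
  not the value of a critical term, then a copy of \<open>X\<close> that keeps the values of the critical terms
  and avoids \<open>a\<close> would have the same generator as \<open>X\<close>, although the generator of a state only
  mentions elements of that state.  Hence the generator of \<open>X\<close> is written down by finitely many
  updates between critical terms.  If the same equalities between critical terms hold in \<open>Y\<close>, then
  a copy of \<open>X\<close> gives every critical term its value in \<open>Y\<close>, so that the generator of \<open>Y\<close> is the image
  of that of \<open>X\<close>, and the rule found for \<open>X\<close> is correct at \<open>Y\<close>.  There are finitely many patterns of
  equalities, and each of them is tested by a Boolean term.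
\<close>

section \<open>Isomorphic copies\<close>

text \<open>Removing finitely many points from an infinite type leaves a set in bijection with the
  whole. Hence the complement of \<open>K\<close> can be matched with what remains outside
  \<open>D\<close> and the image of \<open>K\<close> under \<open>g\<close>, and this matching is
  glued to \<open>g\<close>.\<close>

lemma inj_extending_finite:
  fixes g :: "'a \<Rightarrow> 'a"
  assumes "infinite (UNIV :: 'a set)" "finite K" "inj_on g K" "finite D" "g ` K \<inter> D = {}"
  shows "\<exists>\<zeta>. inj \<zeta> \<and> (\<forall>k\<in>K. \<zeta> k = g k) \<and> range \<zeta> \<inter> D = {}"
proof -
  have cofinite: "\<exists>p. bij_betw p (UNIV :: 'a set) (UNIV - B)" if "finite B" for B :: "'a set"
    using that
  proof (induction B rule: finite_induct)
    case empty
    show ?case using bij_betw_id[of UNIV] by auto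
  next
    case (insert b B)
    then obtain p where p: "bij_betw p (UNIV :: 'a set) (UNIV - B)" by blast
    obtain q where "bij_betw q (UNIV - B) (UNIV - B - {b})"
      using infinite_imp_bij_betw[of "UNIV - B" b] insert.hyps assms(1) by auto
    then have "bij_betw (q \<circ> p) UNIV (UNIV - insert b B)"
      unfolding Diff_insert[of UNIV b B] by (rule bij_betw_trans[OF p])
    then show ?case by blast
  qed
  obtain p where p: "bij_betw p (UNIV :: 'a set) (UNIV - K)"
    using cofinite[OF assms(2)] by blast
  have "finite (g ` K \<union> D)"
    using assms(2,4) by simp
  then obtain q where q: "bij_betw q (UNIV :: 'a set) (UNIV - (g ` K \<union> D))"
    using cofinite by blast
  obtain \<pi> where \<pi>: "bij_betw \<pi> (UNIV - K) (UNIV - (g ` K \<union> D))"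
    using bij_betw_trans[OF bij_betw_inv_into[OF p] q] by blast
  let ?\<zeta> = "\<lambda>x. if x \<in> K then g x else \<pi> x"
  have im: "\<pi> x \<notin> g ` K" "\<pi> x \<notin> D" if "x \<notin> K" for x
    using bij_betwE[OF \<pi>] that by auto
  have "inj ?\<zeta>"
  proof (rule injI)
    fix x y assume eq: "?\<zeta> x = ?\<zeta> y"
    show "x = y"
      using eq im[of x] im[of y] inj_onD[OF assms(3), of x y]
        inj_onD[OF bij_betw_imp_inj_on[OF \<pi>], of x y]
      by (cases "x \<in> K"; cases "y \<in> K") (auto simp: image_iff)
  qed
  moreover have "range ?\<zeta> \<inter> D = {}"
    using im(2) assms(5) by auto
  ultimately show ?thesis
    by (intro exI[of _ ?\<zeta>]) auto
qed

text \<open>Arguments are pulled back along \<open>inv \<zeta>\<close>, which undoes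
  \<open>\<zeta>\<close> because the copy is only used for injective \<open>\<zeta>\<close>. The
  value \<open>undefined\<close> off the locations is what \<open>struct_over\<close>
  demands.\<close>

definition copy :: "'f vocab \<Rightarrow> ('a \<Rightarrow> 'a) \<Rightarrow> ('f, 'a) struct \<Rightarrow> ('f, 'a) struct" where
  "copy V \<zeta> X = \<lparr>base = \<zeta> ` base X,
     interp = (\<lambda>f bs. if f \<in> syms V \<and> length bs = arity V f \<and> set bs \<subseteq> \<zeta> ` base X
       then \<zeta> (interp X f (map (inv \<zeta>) bs)) else undefined)\<rparr>"

lemma copy_struct_over:
  assumes "inj \<zeta>" "struct_over V X"
  shows "struct_over V (copy V \<zeta> X)"
proof -
  have "location V X f (map (inv \<zeta>) bs)"
    if "f \<in> syms V" "length bs = arity V f" "set bs \<subseteq> \<zeta> ` base X" for f bs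
    using that assms(1) by (auto simp: location_def)
  then show ?thesis
    using assms(2) by (auto simp: struct_over_def copy_def location_def)
qed

lemma isomorphism_copy:
  assumes "inj \<zeta>"
  shows "isomorphism V \<zeta> X (copy V \<zeta> X)"
  using assms
  by (auto simp: isomorphism_def copy_def location_def bij_betw_def inj_on_def comp_def)

section \<open>Locations and term values under isomorphisms\<close>

lemma location_isomorphism_iff:
  assumes "isomorphism V \<zeta> X Y"
  shows "location V Y f bs \<longleftrightarrow> (\<exists>as. bs = map \<zeta> as \<and> location V X f as)"
proof -
  have base: "base Y = \<zeta> ` base X"
    using assms by (auto simp: isomorphism_def bij_betw_def)
  have "set bs \<subseteq> \<zeta> ` base X \<longleftrightarrow> (\<exists>as. bs = map \<zeta> as \<and> set as \<subseteq> base X)"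
    using lists_image[of \<zeta> "base X"] by (auto simp: lists_eq_set set_eq_iff image_iff)
  then show ?thesis
    unfolding location_def base by auto
qed

lemma interp_in_base:
  "struct_over V X \<Longrightarrow> location V X f as \<Longrightarrow> interp X f as \<in> base X"
  by (simp add: struct_over_def)

lemma val_in_base:
  assumes "struct_over V X"
  shows "term_over V t \<Longrightarrow> val X t \<in> base X"
  by (induction t) (auto intro!: interp_in_base[OF assms] simp: location_def)

text \<open>An isomorphism commutes with the symbols only at locations, so the induction also uses
  that the argument values lie in the base set.\<close>

lemma val_isomorphism:
  assumes "struct_over V X" "isomorphism V \<zeta> X Y"
  shows "term_over V t \<Longrightarrow> val Y t = \<zeta> (val X t)"
proof (induction t)
  case (App f ts)
  have "location V X f (map (val X) ts)"
    using App.prems val_in_base[OF assms(1)] by (auto simp: location_def)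
  moreover have "map (val Y) ts = map \<zeta> (map (val X) ts)"
    using App by simp
  ultimately show ?case
    using assms(2) unfolding isomorphism_def val.simps by metis
qed


section \<open>Generators under isomorphisms\<close>

abbreviation map_update :: "('a \<Rightarrow> 'a) \<Rightarrow> ('f, 'a) update \<Rightarrow> ('f, 'a) update" where
  "map_update \<zeta> \<equiv> map_prod id (map_prod (map \<zeta>) \<zeta>)"

text \<open>In a linear order \<open>LEAST\<close> may denote nothing sensible; here the witness of
  discreteness is itself the least moment of \<open>I\<close> after \<open>i\<close>.\<close>

lemma succ_moment_in_timeline:
  assumes "discrete I i"
  shows "succ_moment I i \<in> I"
proof -
  obtain t where t: "t \<in> I" "i < t" "\<not> (\<exists>t'\<in>I. i < t' \<and> t' < t)"
    using assms by (auto simp: discrete_def)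
  then have "succ_moment I i = t"
    unfolding succ_moment_def by (intro Least_equality) (auto simp: not_less)
  with t show ?thesis by simp
qed

text \<open>One map \<open>\<zeta>\<close> serves both pairs and is injective on the common base
  set, so a value changes from \<open>X\<close> to \<open>X'\<close> exactly where its image changes
  from \<open>Y\<close> to \<open>Y'\<close>.\<close>

lemma struct_diff_isomorphism:
  assumes "struct_over V X" "struct_over V X'" "base X' = base X"
    and iso: "isomorphism V \<zeta> X Y" and iso': "isomorphism V \<zeta> X' Y'"
  shows "struct_diff V Y' Y = map_update \<zeta> ` struct_diff V X' X"
proof -
  have loc: "location V X' f as \<longleftrightarrow> location V X f as" for f as
    by (simp add: location_def assms(3))
  have inj: "inj_on \<zeta> (base X)"
    using iso by (simp add: isomorphism_def bij_betw_def)
  have int: "interp Y f (map \<zeta> as) = \<zeta> (interp X f as)"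
    "interp Y' f (map \<zeta> as) = \<zeta> (interp X' f as)"
    "\<zeta> (interp X' f as) = \<zeta> (interp X f as) \<longleftrightarrow> interp X' f as = interp X f as"
    if "location V X f as" for f as
    using iso iso' loc that inj_on_eq_iff[OF inj] interp_in_base[OF assms(1), of f as]
      interp_in_base[OF assms(2), of f as] assms(3)
    by (simp_all add: isomorphism_def)
  show ?thesis
  proof (intro equalityI subsetI)
    fix u assume "u \<in> struct_diff V Y' Y"
    then obtain f as where "u = (f, map \<zeta> as, interp Y' f (map \<zeta> as))" "location V X f as"
      "interp Y' f (map \<zeta> as) \<noteq> interp Y f (map \<zeta> as)"
      by (auto simp: struct_diff_def location_isomorphism_iff[OF iso])
    then have "u = map_update \<zeta> (f, as, interp X' f as)"
      "(f, as, interp X' f as) \<in> struct_diff V X' X"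
      by (auto simp: int struct_diff_def)
    then show "u \<in> map_update \<zeta> ` struct_diff V X' X" by blast
  next
    fix u assume "u \<in> map_update \<zeta> ` struct_diff V X' X"
    then obtain f as where "u = (f, map \<zeta> as, \<zeta> (interp X' f as))" "location V X f as"
      "interp X' f as \<noteq> interp X f as"
      by (auto simp: struct_diff_def)
    then have "u = (f, map \<zeta> as, interp Y' f (map \<zeta> as))" "location V Y f (map \<zeta> as)"
      "interp Y' f (map \<zeta> as) \<noteq> interp Y f (map \<zeta> as)"
      by (auto simp: int location_isomorphism_iff[OF iso])
    then show "u \<in> struct_diff V Y' Y"
      unfolding struct_diff_def by blast
  qed
qed

text \<open>The horizon is not related by isomorphisms, but initial constancy does not depend on it.\<close>

lemma initially_constant_evolution_iff:
  assumes "horizon_for V A h" "X \<in> states A" "location V X f as" "0 \<in> tline A X"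
  shows "initially_constant (evolution A h X f as) \<longleftrightarrow>
    (\<exists>t\<in>tline A X. 0 < t \<and>
       (\<forall>s\<in>tline A X. 0 \<le> s \<and> s \<le> t \<longrightarrow> interp (traj A X s) f as = interp (traj A X 0) f as))"
    (is "?L \<longleftrightarrow> ?R")
proof -
  let ?h = "h X f as"
  have h: "?h \<in> tline A X" "0 \<le> ?h" "\<And>t. t \<in> tline A X \<Longrightarrow> 0 < t \<Longrightarrow> 0 < ?h"
    using assms unfolding horizon_for_def by blast+
  have dom: "t \<in> dom (evolution A h X f as) \<longleftrightarrow> t \<in> tline A X \<and> 0 \<le> t \<and> t \<le> ?h" for t
    by (simp add: evolution_def dom_def)
  show ?thesis
  proof
    assume ?L
    then obtain t where t: "t \<in> tline A X" "0 < t" "t \<le> ?h"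
      and c: "\<And>s. s \<in> tline A X \<Longrightarrow> 0 \<le> s \<Longrightarrow> s \<le> t \<Longrightarrow>
        evolution A h X f as s = evolution A h X f as 0"
      unfolding initially_constant_def Bex_def Ball_def dom by fastforce
    have "interp (traj A X s) f as = interp (traj A X 0) f as"
      if "s \<in> tline A X" "0 \<le> s" "s \<le> t" for s
      using c[OF that] that t h(2) by (auto simp: evolution_def split: if_splits)
    with t show ?R by blast
  next
    assume ?R
    then obtain t where t: "t \<in> tline A X" "0 < t"
      and c: "\<And>s. s \<in> tline A X \<Longrightarrow> 0 \<le> s \<Longrightarrow> s \<le> t \<Longrightarrow>
        interp (traj A X s) f as = interp (traj A X 0) f as"
      by blast
    \<comment> \<open>The moment \<open>t\<close> may lie beyond the horizon. Cut down to it, it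
      stays positive, since the horizon is positive once the timeline has a positive moment.\<close>
    have m: "min t ?h \<in> dom (evolution A h X f as)" "0 < min t ?h"
      using t h unfolding dom by (auto simp: min_def)
    have "evolution A h X f as s = evolution A h X f as 0"
      if "s \<in> dom (evolution A h X f as)" "s \<le> min t ?h" for s
    proof -
      from that(1) have s: "s \<in> tline A X" "0 \<le> s" "s \<le> ?h" unfolding dom by auto
      with c[of s] that(2) h(2) assms(4) show ?thesis by (simp add: evolution_def)
    qed
    with m show ?L unfolding initially_constant_def by blast
  qed
qed


section \<open>States of a fixed transition system and their generators\<close>

locale asm_setting =
  fixes V :: "'f vocab"
    and \<C> :: "'a set set"
    and \<psi> :: "('tm::time_domain, 'a) semantics"
    and h :: "('f, 'a, 'tm) horizon"
    and A :: "(('f, 'a) struct, 'tm) system"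
  assumes infinite_universe: "infinite (UNIV :: 'a set)"
    and vocab: "vocabulary V"
    and semantics: "semantics_over \<C> \<psi>"
    and horizon: "horizon_for V A h"
    and ats: "abstract_transition_system V A"
    and psi_iso: "psi_iso_invariant V \<psi> h A"
begin

lemma state_facts:
  assumes "X \<in> states A"
  shows "struct_over V X" "0 \<in> tline A X" "traj A X 0 = X"
    "\<And>i. i \<in> tline A X \<Longrightarrow> traj A X i \<in> states A"
    "\<And>i. i \<in> tline A X \<Longrightarrow> base (traj A X i) = base X"
proof -
  have "dynamical_system A" and s: "\<forall>X\<in>states A. struct_over V X"
    and b: "\<forall>X\<in>states A. \<forall>i\<in>tline A X. base (traj A X i) = base X"
    using ats unfolding abstract_transition_system_def by - (elim conjE, assumption)+
  then have z: "\<forall>X\<in>states A. timeline (tline A X) \<and> non_Zeno (tline A X)"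
    and t: "\<forall>X\<in>states A. \<forall>i\<in>tline A X. traj A X i \<in> states A"
    and 0: "\<forall>X\<in>states A. traj A X 0 = X"
    unfolding dynamical_system_def by - (elim conjE, assumption)+
  show "struct_over V X" "0 \<in> tline A X" "traj A X 0 = X"
    using s z 0 assms by (simp_all add: timeline_def)
  show "traj A X i \<in> states A" "base (traj A X i) = base X" if "i \<in> tline A X" for i
    using t b assms that by simp_all
qed

lemma isomorphic_states:
  assumes "X \<in> states A" "Y \<in> states A" "isomorphism V \<zeta> X Y"
  shows "tline A Y = tline A X"
    "\<And>i. i \<in> tline A X \<Longrightarrow> isomorphism V \<zeta> (traj A X i) (traj A Y i)"
proof -
  have "\<forall>X\<in>states A. \<forall>Y\<in>states A. \<forall>\<zeta>. isomorphism V \<zeta> X Y \<longrightarrow>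
      tline A X = tline A Y \<and> (\<forall>i\<in>tline A X. isomorphism V \<zeta> (traj A X i) (traj A Y i))"
    using ats unfolding abstract_transition_system_def by - (elim conjE, assumption)
  from this[rule_format, OF assms] show "tline A Y = tline A X"
    "\<And>i. i \<in> tline A X \<Longrightarrow> isomorphism V \<zeta> (traj A X i) (traj A Y i)"
    by simp_all
qed

lemma copy_state:
  assumes "X \<in> states A" "inj \<zeta>"
  shows "copy V \<zeta> X \<in> states A"
proof -
  have "struct_over V (copy V \<zeta> X)" "isomorphism V \<zeta> X (copy V \<zeta> X)"
    using assms copy_struct_over isomorphism_copy state_facts(1) by blast+
  moreover have "\<forall>X\<in>states A. \<forall>Y \<zeta>. struct_over V Y \<and> isomorphism V \<zeta> X Y \<longrightarrow>
      Y \<in> states A \<and> (X \<in> initial A \<longrightarrow> Y \<in> initial A)"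
    using ats unfolding abstract_transition_system_def by - (elim conjE, assumption)
  ultimately show ?thesis
    using assms(1) by blast
qed

text \<open>The horizons at \<open>X\<close> and \<open>Y\<close> may differ, so both sides are
  first freed of them. What remains compares values along the common timeline with values at
  \<open>0\<close>, and \<open>\<zeta>\<close>, injective on the base set, preserves and reflects
  these equalities.\<close>

lemma initially_constant_isomorphism:
  assumes "X \<in> states A" "Y \<in> states A" "isomorphism V \<zeta> X Y" "location V X f as"
  shows "initially_constant (evolution A h Y f (map \<zeta> as)) \<longleftrightarrow>
    initially_constant (evolution A h X f as)"
proof -
  note X = state_facts[OF assms(1)] and Y = state_facts[OF assms(2)]
  note tl = isomorphic_states[OF assms(1-3)]
  have loc: "location V Y f (map \<zeta> as)"
    using location_isomorphism_iff[OF assms(3)] assms(4) by blast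
  have locX: "location V (traj A X s) f as" if "s \<in> tline A X" for s
    using X(5)[OF that] assms(4) by (simp add: location_def)
  have int: "interp (traj A Y s) f (map \<zeta> as) = \<zeta> (interp (traj A X s) f as)"
    "interp (traj A X s) f as \<in> base X" if "s \<in> tline A X" for s
    using tl(2)[OF that] locX[OF that] X(5)[OF that]
      interp_in_base[OF state_facts(1)[OF X(4)[OF that]] locX[OF that]]
    by (simp_all add: isomorphism_def)
  have "inj_on \<zeta> (base X)"
    using assms(3) by (simp add: isomorphism_def bij_betw_def)
  then have eq: "interp (traj A Y s) f (map \<zeta> as) = interp (traj A Y 0) f (map \<zeta> as) \<longleftrightarrow>
      interp (traj A X s) f as = interp (traj A X 0) f as" if "s \<in> tline A X" for s
    unfolding int(1)[OF that] int(1)[OF X(2)] using int(2)[OF that] int(2)[OF X(2)]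
    by (rule inj_on_eq_iff)
  show ?thesis
    unfolding initially_constant_evolution_iff[OF horizon assms(2) loc Y(2)]
      initially_constant_evolution_iff[OF horizon assms(1,4) X(2)] tl(1)
    by (simp add: eq)
qed

text \<open>For a jump, the common timeline gives the same next moment, and differences are
  transported. For a flow, initial constancy agrees and \<open>psi_iso\<close> transports the
  values. That invariance is silent at initially constant locations, where \<psi> must still be
  defined, so existence of the generator at \<open>Y\<close> is assumed.\<close>

lemma gen_isomorphism:
  assumes XY: "X \<in> states A" "Y \<in> states A" and iso: "isomorphism V \<zeta> X Y"
    and gX: "gen V \<psi> h A X = Some (tg, U)" and gY: "gen V \<psi> h A Y \<noteq> None"
  shows "gen V \<psi> h A Y = Some (tg, map_update \<zeta> ` U)"
proof -
  note X = state_facts[OF XY(1)]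
  note tl = isomorphic_states[OF XY iso]
  have jump: "jump A Y \<longleftrightarrow> jump A X"
    by (simp add: jump_def tl(1))
  show ?thesis
  proof (cases "jump A X")
    case True
    let ?m = "succ_moment (tline A X) 0"
    have m: "?m \<in> tline A X"
      using True by (simp add: jump_def succ_moment_in_timeline)
    have "jump_updates V A Y = map_update \<zeta> ` jump_updates V A X"
      unfolding jump_updates_def tl(1)
      by (rule struct_diff_isomorphism[OF X(1) _ X(5)[OF m] iso tl(2)[OF m]])
        (rule state_facts(1)[OF X(4)[OF m]])
    then show ?thesis
      using gX True jump by (simp add: gen_def)
  next
    case False
    let ?p = "\<lambda>X f as. the (psi_value \<psi> h A X f as)"
    let ?ic = "\<lambda>X f as. initially_constant (evolution A h X f as)"
    let ?W = "\<lambda>X. {(f, as, ?p X f as) | f as. location V X f as \<and> \<not> ?ic X f as}"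
    have U: "tg = FlowTag" "U = ?W X"
      using gX False by (auto simp: gen_def flow_updates_def split: if_splits)
    have defined: "psi_value \<psi> h A X f as \<noteq> None" if "location V X f as" for f as
      using that gX False by (auto simp: gen_def flow_updates_def split: if_splits)
    have p: "?p Y f (map \<zeta> as) = \<zeta> (?p X f as)"
      if "location V X f as" "\<not> ?ic X f as" for f as
    proof -
      have "psi_value \<psi> h A Y f (map \<zeta> as) = map_option \<zeta> (psi_value \<psi> h A X f as)"
        using psi_iso XY iso False that unfolding psi_iso_invariant_def by blast
      then show ?thesis
        using defined[OF that(1)] by auto
    qed
    note ic = initially_constant_isomorphism[OF XY iso]
    have "?W Y = map_update \<zeta> ` ?W X"
    proof (intro equalityI subsetI)
      fix u assume "u \<in> ?W Y"
      then obtain f as where "u = (f, map \<zeta> as, ?p Y f (map \<zeta> as))" "location V X f as"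
        "\<not> ?ic Y f (map \<zeta> as)"
        by (auto simp: location_isomorphism_iff[OF iso])
      then have "u = map_update \<zeta> (f, as, ?p X f as)" "(f, as, ?p X f as) \<in> ?W X"
        by (auto simp: ic p)
      then show "u \<in> map_update \<zeta> ` ?W X" by blast
    next
      fix u assume "u \<in> map_update \<zeta> ` ?W X"
      then obtain f as where "u = (f, map \<zeta> as, \<zeta> (?p X f as))" "location V X f as"
        "\<not> ?ic X f as"
        by auto
      then have "u = (f, map \<zeta> as, ?p Y f (map \<zeta> as))" "location V Y f (map \<zeta> as)"
        "\<not> ?ic Y f (map \<zeta> as)"
        by (auto simp: ic p location_isomorphism_iff[OF iso])
      then show "u \<in> ?W Y" by blast
    qed
    moreover have "gen V \<psi> h A Y = Some (FlowTag, ?W Y)"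
      using gY False jump by (auto simp: gen_def flow_updates_def split: if_splits)
    ultimately show ?thesis
      using U by simp
  qed
qed

text \<open>A jump writes values of the successor state, whose base set is that of \<open>X\<close>;
  a flow writes values of \<psi>, which by \<open>semantics_over\<close> lie in the set handed to
  it.\<close>

lemma gen_update_in_base:
  assumes X: "X \<in> states A" and gX: "gen V \<psi> h A X = Some (tg, U)" and u: "(f, as, b) \<in> U"
  shows "location V X f as" "b \<in> base X"
proof -
  have "location V X f as \<and> b \<in> base X"
  proof (cases "jump A X")
    case True
    let ?m = "succ_moment (tline A X) 0"
    let ?X' = "traj A X ?m"
    have m: "?m \<in> tline A X"
      using True by (simp add: jump_def succ_moment_in_timeline)
    have "location V X f as" "b = interp ?X' f as"
      using gX u True by (auto simp: gen_def jump_updates_def struct_diff_def)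
    moreover from this have "location V ?X' f as"
      using state_facts(5)[OF X m] by (simp add: location_def)
    ultimately show ?thesis
      using interp_in_base[OF state_facts(1)[OF state_facts(4)[OF X m]]] state_facts(5)[OF X m]
      by simp
  next
    case False
    then have loc: "location V X f as" "b = the (psi_value \<psi> h A X f as)"
      and "psi_value \<psi> h A X f as \<noteq> None"
      using gX u by (auto simp: gen_def flow_updates_def split: if_splits)
    then have "\<psi> (base X) (evolution A h X f as) = Some b"
      by (auto simp: psi_value_def)
    then have "b \<in> base X"
      using semantics unfolding semantics_over_def by blast
    with loc show ?thesis by simp
  qed
  then show "location V X f as" "b \<in> base X" by simp_all
qed

end


section \<open>From critical terms to programs\<close>

locale critical_terms = asm_setting V \<C> \<psi> h A
  for V :: "'f vocab" and \<C> :: "'a set set" and \<psi> :: "('tm::time_domain, 'a) semantics"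
    and h :: "('f, 'a, 'tm) horizon" and A :: "(('f, 'a) struct, 'tm) system" +
  fixes T :: "'f gterm set"
  assumes finite_T: "finite T"
    and terms_T: "t \<in> T \<Longrightarrow> term_over V t"
    and gen_defined: "X \<in> states A \<Longrightarrow> gen V \<psi> h A X \<noteq> None"
    and gen_determined: "X \<in> states A \<Longrightarrow> Y \<in> states A \<Longrightarrow> (\<And>t. t \<in> T \<Longrightarrow> val X t = val Y t) \<Longrightarrow>
      gen V \<psi> h A X = gen V \<psi> h A Y"
begin

lemma gen_updates_critical:
  assumes X: "X \<in> states A" and gX: "gen V \<psi> h A X = Some (tg, U)" and u: "(f, as, b) \<in> U"
  shows "set as \<subseteq> val X ` T" "b \<in> val X ` T"
proof -
  have "a \<in> val X ` T" if a: "a = b \<or> a \<in> set as" for a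
  proof (rule ccontr)
    assume "a \<notin> val X ` T"
    \<comment> \<open>The identity on the finitely many critical values extends to an injection that
      misses \<open>a\<close>.\<close>
    then obtain \<zeta> where \<zeta>: "inj \<zeta>" "\<And>k. k \<in> val X ` T \<Longrightarrow> \<zeta> k = k" "range \<zeta> \<inter> {a} = {}"
      using inj_extending_finite[OF infinite_universe, of "val X ` T" id "{a}"] finite_T by auto
    let ?Y = "copy V \<zeta> X"
    have Y: "?Y \<in> states A"
      using copy_state X \<zeta>(1) .
    have "val X t = val ?Y t" if "t \<in> T" for t
      using val_isomorphism[OF state_facts(1)[OF X] isomorphism_copy[OF \<zeta>(1)] terms_T[OF that]]
        \<zeta>(2)[of "val X t"] that by simp
    \<comment> \<open>The copy has the very same \<open>U\<close>, not merely its image, so the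
      given update must fit into the base set of the copy.\<close>
    then have "gen V \<psi> h A ?Y = Some (tg, U)"
      using gen_determined[OF X Y] gX by simp
    then have "location V ?Y f as" "b \<in> base ?Y"
      using gen_update_in_base[OF Y _ u] by blast+
    then have "a \<in> base ?Y"
      using a by (auto simp: location_def)
    then show False
      using \<zeta>(3) by (auto simp: copy_def)
  qed
  then show "set as \<subseteq> val X ` T" "b \<in> val X ` T" by auto
qed

section \<open>Equality patterns and the rule attached to one pattern\<close>

definition pattern :: "('f, 'a) struct \<Rightarrow> ('f gterm \<times> 'f gterm) set" where
  "pattern X = {(s, t) \<in> T \<times> T. val X s = val X t}"

text \<open>The states \<open>X\<close> and \<open>Y\<close> need not be isomorphic. A copy of
  \<open>X\<close> mediates: it agrees with \<open>Y\<close> on the critical terms, so its generator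
  is both the image of that of \<open>X\<close> and equal to that of \<open>Y\<close>.\<close>

lemma gen_same_pattern:
  assumes X: "X \<in> states A" and Y: "Y \<in> states A" and same: "pattern Y = pattern X"
    and gX: "gen V \<psi> h A X = Some (tg, U)"
  obtains \<zeta> where "\<forall>t\<in>T. \<zeta> (val X t) = val Y t"
    "gen V \<psi> h A Y = Some (tg, map_update \<zeta> ` U)"
proof -
  have eq: "val Y s = val Y t \<longleftrightarrow> val X s = val X t" if "s \<in> T" "t \<in> T" for s t
    using same that by (auto simp: pattern_def set_eq_iff)
  \<comment> \<open>Which term is chosen for a critical value does not matter: critical terms equal
    in \<open>X\<close> are equal in \<open>Y\<close>. The converse makes \<open>g\<close> injective
    on the critical values.\<close>
  define g where "g = (\<lambda>a. val Y (SOME t. t \<in> T \<and> val X t = a))"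
  have g: "g (val X t) = val Y t" if "t \<in> T" for t
    using someI[of "\<lambda>s. s \<in> T \<and> val X s = val X t" t] that eq by (simp add: g_def)
  have "inj_on g (val X ` T)"
    using g eq by (auto simp: inj_on_def)
  then obtain \<zeta> where \<zeta>: "inj \<zeta>" "\<And>k. k \<in> val X ` T \<Longrightarrow> \<zeta> k = g k"
    using inj_extending_finite[OF infinite_universe, of "val X ` T" g "{}"] finite_T by auto
  let ?Z = "copy V \<zeta> X"
  have Z: "?Z \<in> states A"
    using copy_state X \<zeta>(1) .
  have \<zeta>_val: "\<zeta> (val X t) = val Y t" if "t \<in> T" for t
    using \<zeta>(2) g that by simp
  have "val ?Z t = val Y t" if "t \<in> T" for t
    using val_isomorphism[OF state_facts(1)[OF X] isomorphism_copy[OF \<zeta>(1)] terms_T[OF that]]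
      \<zeta>_val[OF that] by simp
  then have "gen V \<psi> h A Y = gen V \<psi> h A ?Z"
    using gen_determined[OF Z Y] by simp
  also have "\<dots> = Some (tg, map_update \<zeta> ` U)"
    using gen_isomorphism[OF X Z isomorphism_copy[OF \<zeta>(1)] gX gen_defined[OF Z]] .
  finally have gY: "gen V \<psi> h A Y = Some (tg, map_update \<zeta> ` U)" .
  show thesis
    by (rule that[OF _ gY]) (simp add: \<zeta>_val)
qed

text \<open>Symbols are finitely many, and arguments and new value range over the finite set of
  critical values, with tuple length bounded by the arity. Finiteness lets a rule, which is a finite
  list, express \<open>U\<close>.\<close>

lemma finite_gen:
  assumes X: "X \<in> states A" and gX: "gen V \<psi> h A X = Some (tg, U)"
  shows "finite U"
proof (rule finite_subset)
  let ?K = "val X ` T"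
  let ?S = "SIGMA f : syms V. {as. set as \<subseteq> ?K \<and> length as = arity V f} \<times> ?K"
  have S: "(f, as, b) \<in> ?S" if "(f, as, b) \<in> U" for f as b
    using gen_update_in_base(1)[OF X gX that] gen_updates_critical[OF X gX that]
    by (simp add: location_def)
  show "U \<subseteq> ?S"
  proof
    fix u assume "u \<in> U"
    then show "u \<in> ?S"
      using S by (cases u) (simp only:)
  qed
  show "finite ?S"
    using vocab finite_T
    by (auto simp: vocabulary_def intro!: finite_SigmaI finite_lists_length_eq)
qed

text \<open>A list of symbolic updates, to be read as a parallel or as a flow rule.\<close>

lemma gen_symbolic:
  assumes X: "X \<in> states A" and gX: "gen V \<psi> h A X = Some (tg, U)"
  obtains us where
    "\<forall>(f, ts, t)\<in>set us. term_over V (App f ts) \<and> set ts \<subseteq> T \<and> t \<in> T"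
    "U = (\<lambda>(f, ts, t). (f, map (val X) ts, val X t)) ` set us"
proof -
  \<comment> \<open>One critical term is chosen for each critical value; as all elements occurring
    in \<open>U\<close> are critical, evaluation in \<open>X\<close> undoes the choice.\<close>
  define \<tau> where "\<tau> = inv_into T (val X)"
  have \<tau>: "\<tau> a \<in> T" "val X (\<tau> a) = a" if "a \<in> val X ` T" for a
    using that by (simp_all add: \<tau>_def inv_into_into f_inv_into_f)
  obtain us' where us': "set us' = U"
    using finite_list[OF finite_gen[OF X gX]] by blast
  define us where "us = map (\<lambda>(f, as, b). (f, map \<tau> as, \<tau> b)) us'"
  have ok: "term_over V (App f ts) \<and> set ts \<subseteq> T \<and> t \<in> T" if "(f, ts, t) \<in> set us" for f ts t
  proof -
    obtain as b where u: "(f, as, b) \<in> U" "ts = map \<tau> as" "t = \<tau> b"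
      using \<open>(f, ts, t) \<in> set us\<close> us' by (auto simp: us_def)
    have "set ts \<subseteq> T" "t \<in> T"
      using gen_updates_critical[OF X gX u(1)] \<tau>(1) u by auto
    then show ?thesis
      using gen_update_in_base(1)[OF X gX u(1)] u(2) terms_T by (auto simp: location_def)
  qed
  have U: "U = (\<lambda>(f, ts, t). (f, map (val X) ts, val X t)) ` set us"
  proof -
    have recover: "(f, map (val X) (map \<tau> as), val X (\<tau> b)) = (f, as, b)" if "(f, as, b) \<in> U" for f as b
      using gen_updates_critical[OF X gX that] \<tau>(2) by (auto intro!: map_idI)
    have "(\<lambda>(f, ts, t). (f, map (val X) ts, val X t)) ` set us =
        (\<lambda>(f, as, b). (f, map (val X) (map \<tau> as), val X (\<tau> b))) ` U"
      by (auto simp: us_def us'[symmetric] image_image case_prod_beta)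
    also have "\<dots> = (\<lambda>u. u) ` U"
      using recover by (intro image_cong refl) (auto simp del: map_map)
    finally show ?thesis by simp
  qed
  show thesis
    by (rule that[OF _ U]) (use ok in auto)
qed

text \<open>Passing from \<open>X\<close> to a state of the same pattern applies one map \<zeta>
  both to the generator and to the values of the critical terms from which the rule is
  built.\<close>

lemma rule_for_pattern:
  assumes X: "X \<in> states A"
  shows "\<exists>R. asm_program V R \<and>
    (\<forall>Y\<in>states A. pattern Y = pattern X \<longrightarrow> gen V \<psi> h A Y = Some (gen_rule V R Y))"
proof -
  obtain tg U where gX: "gen V \<psi> h A X = Some (tg, U)"
    using gen_defined[OF X] by auto
  obtain us where us: "\<forall>(f, ts, t)\<in>set us. term_over V (App f ts) \<and> set ts \<subseteq> T \<and> t \<in> T"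
    and U: "U = (\<lambda>(f, ts, t). (f, map (val X) ts, val X t)) ` set us"
    by (rule gen_symbolic[OF X gX])
  \<comment> \<open>The tag found at \<open>X\<close> can be built into the rule, since states of
    equal pattern have equal tags. An empty \<open>us\<close> gives an empty \<open>Par\<close> or
    \<open>Flow\<close>.\<close>
  define R where "R = (case tg of
      JumpTag \<Rightarrow> Par (map (\<lambda>(f, ts, t). Update f ts t) us)
    | FlowTag \<Rightarrow> Flow (map (\<lambda>(f, ts, t). Dynamic f ts t) us))"
  have "asm_program V R"
    using us terms_T by (cases tg) (fastforce simp: R_def)+
  moreover have "gen V \<psi> h A Y = Some (gen_rule V R Y)"
    if Y: "Y \<in> states A" and same: "pattern Y = pattern X" for Y
  proof -
    obtain \<zeta> where \<zeta>: "\<forall>t\<in>T. \<zeta> (val X t) = val Y t"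
      and gY: "gen V \<psi> h A Y = Some (tg, map_update \<zeta> ` U)"
      by (rule gen_same_pattern[OF X Y same gX])
    have eval: "map \<zeta> (map (val X) ts) = map (val Y) ts" "\<zeta> (val X t) = val Y t"
      if "(f, ts, t) \<in> set us" for f ts t
    proof -
      have "set ts \<subseteq> T" "t \<in> T"
        using us that by auto
      then show "map \<zeta> (map (val X) ts) = map (val Y) ts" "\<zeta> (val X t) = val Y t"
        using \<zeta> by auto
    qed
    have "map_update \<zeta> ` U = (\<lambda>(f, ts, t). (f, map (val Y) ts, val Y t)) ` set us"
      unfolding U image_image using eval by (intro image_cong refl) (auto simp del: map_map)
    moreover have "gen_rule V R Y = (tg, (\<lambda>(f, ts, t). (f, map (val Y) ts, val Y t)) ` set us)"
      by (cases tg) (simp_all add: R_def case_prod_beta UNION_singleton_eq_range)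
    ultimately show ?thesis
      using gY by simp
  qed
  ultimately show ?thesis by blast
qed

section \<open>Testing patterns and assembling the program\<close>

lemma pattern_test:
  "\<exists>b. bterm_over V b \<and> (\<forall>X. holds V X b \<longleftrightarrow> pattern X = P \<inter> T \<times> T)"
proof -
  have conj: "\<exists>b. bterm_over V b \<and>
      (\<forall>X :: ('f, 'a) struct. holds V X b \<longleftrightarrow> (\<forall>(s, t)\<in>Q. val X s = val X t \<longleftrightarrow> (s, t) \<in> P))"
    if "finite Q" "Q \<subseteq> T \<times> T" for Q
    using that
  proof (induction Q rule: finite_induct)
    case empty
    \<comment> \<open>The empty conjunction becomes an equality of \<open>true_sym V\<close> with
      itself, a term available even if there are no critical terms.\<close>
    let ?true = "App (true_sym V) []"
    have "bterm_over V (Eq ?true ?true)"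
      using vocab by (simp add: vocabulary_def)
    then show ?case
      by (intro exI[of _ "Eq ?true ?true"]) simp
  next
    case (insert q Q)
    obtain s t where q: "q = (s, t)" by (cases q)
    have st: "term_over V s" "term_over V t"
      using insert.prems q terms_T by auto
    obtain b where b: "bterm_over V b"
      "\<And>X :: ('f, 'a) struct. holds V X b \<longleftrightarrow> (\<forall>(s, t)\<in>Q. val X s = val X t \<longleftrightarrow> (s, t) \<in> P)"
      using insert by auto
    \<comment> \<open>Equalities outside \<open>P\<close> must be refuted and not just left out, so
      that the test singles out exactly one pattern.\<close>
    let ?c = "if (s, t) \<in> P then Eq s t else Neg (Eq s t)"
    show ?case
      using b st q by (intro exI[of _ "Conj ?c b"]) auto
  qed
  obtain b where b: "bterm_over V b" "\<And>X :: ('f, 'a) struct.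
      holds V X b \<longleftrightarrow> (\<forall>(s, t)\<in>T \<times> T. val X s = val X t \<longleftrightarrow> (s, t) \<in> P)"
    using conj[of "T \<times> T"] finite_T by auto
  then show ?thesis
    by (intro exI[of _ b]) (auto simp: pattern_def set_eq_iff)
qed

text \<open>Induction nests selections: a new pattern contributes a test whose else branch is the
  program for the earlier patterns.\<close>

lemma program_for_patterns:
  assumes "finite \<P>"
  shows "\<exists>\<Pi>. asm_program V \<Pi> \<and>
    (\<forall>X\<in>states A. pattern X \<in> \<P> \<longrightarrow> gen V \<psi> h A X = Some (gen_rule V \<Pi> X))"
  using assms
proof (induction \<P> rule: finite_induct)
  case empty
  \<comment> \<open>No state has to be handled, so any program would do.\<close>
  show ?case by (intro exI[of _ "Par []"]) simp
next
  case (insert P \<P>)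
  obtain \<Pi> where \<Pi>: "asm_program V \<Pi>"
    "\<And>X. X \<in> states A \<Longrightarrow> pattern X \<in> \<P> \<Longrightarrow> gen V \<psi> h A X = Some (gen_rule V \<Pi> X)"
    using insert.IH by blast
  show ?case
  \<comment> \<open>A rule is read off from a state, so only a pattern realised by some state gets a
    branch.\<close>
  proof (cases "\<exists>X\<in>states A. pattern X = P")
    case True
    then obtain X where X: "X \<in> states A" "pattern X = P" by blast
    obtain R where R: "asm_program V R"
      "\<And>Y. Y \<in> states A \<Longrightarrow> pattern Y = P \<Longrightarrow> gen V \<psi> h A Y = Some (gen_rule V R Y)"
      using rule_for_pattern[OF X(1)] X(2) by blast
    have "P \<inter> T \<times> T = P"
      using X(2) by (auto simp: pattern_def)
    then obtain b where b: "bterm_over V b"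
      "\<And>Y :: ('f, 'a) struct. holds V Y b \<longleftrightarrow> pattern Y = P"
      using pattern_test[of P] by auto
    show ?thesis
      using \<Pi> R b by (intro exI[of _ "Select b R \<Pi>"]) auto
  next
    case False
    with \<Pi> show ?thesis by blast
  qed
qed

lemma program_exists:
  "\<exists>\<Pi>. asm_program V \<Pi> \<and> (\<forall>X\<in>states A. gen V \<psi> h A X = Some (gen_rule V \<Pi> X))"
proof -
  have "pattern X \<subseteq> T \<times> T" for X
    by (auto simp: pattern_def)
  then show ?thesis
    using program_for_patterns[of "Pow (T \<times> T)"] finite_T by simp
qed

end

theorem theorem1:
  fixes V :: "'f vocab"
    and \<C> :: "'a set set"
    and \<psi> :: "('tm::time_domain, 'a) semantics"
    and h :: "('f, 'a, 'tm) horizon"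
    and A :: "(('f, 'a) struct, 'tm) system"
  assumes universe: "infinite (UNIV :: 'a set)"
    and "vocabulary V"
    and "semantics_over \<C> \<psi>"
    and "horizon_for V A h"
    and "algorithm V \<psi> h A"
    and "psi_iso_invariant V \<psi> h A"
  shows "\<exists>\<Pi>. asm_program V \<Pi> \<and>
           (\<forall>X\<in>states A. gen V \<psi> h A X = Some (gen_rule V \<Pi> X))"
proof -
  have ats: "abstract_transition_system V A"
    using assms(5) by (simp add: algorithm_def)
  obtain T where T: "finite T" "\<forall>t\<in>T. term_over V t"
    and crit: "\<forall>X\<in>states A. \<forall>Y\<in>states A. (\<forall>t\<in>T. val X t = val Y t) \<longrightarrow>
      gen V \<psi> h A X \<noteq> None \<and> gen V \<psi> h A Y \<noteq> None \<and> gen V \<psi> h A X = gen V \<psi> h A Y"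
    using assms(5) unfolding algorithm_def by (elim conjE exE)
  interpret critical_terms V \<C> \<psi> h A T
  proof
    show "gen V \<psi> h A X = gen V \<psi> h A Y"
      if "X \<in> states A" "Y \<in> states A" "\<And>t. t \<in> T \<Longrightarrow> val X t = val Y t" for X Y
      using crit[rule_format, OF that] by simp
    \<comment> \<open>Comparing a state with itself turns the condition on critical terms into
      definedness of its generator.\<close>
    show "gen V \<psi> h A X \<noteq> None" if "X \<in> states A" for X
      using crit[rule_format, OF that that] by simp
  qed (use assms T ats in simp_all)
  show ?thesis
    by (rule program_exists)
qed

end
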